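(* Let $R \cong R_1 \times R_2 \times \cdots \times R_n$ with $n \ge 2$, where each $(R_i,\mathcal{M}_i)$ is an Artinian local principal ideal ring with at least two non-trivial (i.e. nonzero proper) ideals. Then $\mathrm{sdim}(\mathrm{PIS}(R)) = |V(\mathrm{PIS}(R))| - n - 1$, where $V(\mathrm{PIS}(R))$ is the vertex set of $\mathrm{PIS}(R)$.
   Context: All rings are commutative with unity; throughout the paper $R$ is an Artinian non-local ring. The prime ideal sum graph $\mathrm{PIS}(R)$ is the simple undirected graph whose vertex set is the set of all nonzero proper ideals of $R$, with two distinct vertices $I$ and $J$ adjacent if and only if $I+J$ is a prime ideal of $R$. In a connected graph, a vertex $w$ strongly resolves vertices $u,v$ if some shortest $u$–$w$ path contains $v$ or some shortest $v$–$w$ path contains $u$. A set $S$ of vertices is a strong resolving set if every pair of distinct vertices is strongly resolved by some vertex of $S$; the strong metric dimension $\mathrm{sdim}$ is the minimum size of a strong resolving set. *)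

theory Defs
  imports "HOL-Algebra.Algebra" "Graph_Theory.Graph_Theory"
begin

section \<open>Commutative rings\<close>

locale artinian_ring = cring +
  assumes descending_chain:
    "\<lbrakk>\<And>k :: nat. ideal (I k) R; \<And>k. I (Suc k) \<subseteq> I k\<rbrakk> \<Longrightarrow> \<exists>m. \<forall>k\<ge>m. I k = I m"

locale local_ring = cring +
  assumes unique_maximalideal: "\<exists>!M. maximalideal M R"

locale principal_ideal_ring = cring +
  assumes all_principal: "ideal I R \<Longrightarrow> principalideal I R"

definition nontrivial_ideals :: "('a, 'm) ring_scheme \<Rightarrow> 'a set set" where
  "nontrivial_ideals R = {I. ideal I R \<and> I \<noteq> {\<zero>\<^bsub>R\<^esub>} \<and> I \<noteq> carrier R}"


section \<open>Strong metric dimension\<close>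

text \<open>An undirected simple graph is represented, as usual in \<^theory>\<open>Graph_Theory.Graph_Theory\<close>, by a
  loop-free pair digraph with a symmetric arc relation. Paths are lists of arcs without repeated
  vertices; the empty list is the path from a vertex to itself.\<close>

definition shortest_path ::
    "'a pair_pre_digraph \<Rightarrow> 'a \<Rightarrow> ('a \<times> 'a) awalk \<Rightarrow> 'a \<Rightarrow> bool" where
  "shortest_path G u p v \<longleftrightarrow>
     pre_digraph.apath (with_proj G) u p v \<and>
     (\<forall>q. pre_digraph.apath (with_proj G) u q v \<longrightarrow> length p \<le> length q)"

definition strongly_resolves :: "'a pair_pre_digraph \<Rightarrow> 'a \<Rightarrow> 'a \<Rightarrow> 'a \<Rightarrow> bool" where
  "strongly_resolves G w u v \<longleftrightarrow>
     (\<exists>p. shortest_path G u p w \<and> v \<in> set (pre_digraph.awalk_verts (with_proj G) u p)) \<or>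
     (\<exists>p. shortest_path G v p w \<and> u \<in> set (pre_digraph.awalk_verts (with_proj G) v p))"

definition strong_resolving_set :: "'a pair_pre_digraph \<Rightarrow> 'a set \<Rightarrow> bool" where
  "strong_resolving_set G S \<longleftrightarrow>
     S \<subseteq> pverts G \<and>
     (\<forall>u\<in>pverts G. \<forall>v\<in>pverts G. u \<noteq> v \<longrightarrow> (\<exists>w\<in>S. strongly_resolves G w u v))"

text \<open>Meaningful for connected graphs that have a finite strong resolving set, in particular for
  finite connected graphs. Finiteness is required explicitly because \<^const>\<open>card\<close> is 0 on
  infinite sets.\<close>

definition sdim :: "'a pair_pre_digraph \<Rightarrow> nat" where
  "sdim G = (LEAST k. \<exists>S. strong_resolving_set G S \<and> finite S \<and> card S = k)"


section \<open>The prime ideal sum graph\<close>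

definition PIS :: "('a, 'm) ring_scheme \<Rightarrow> 'a set pair_pre_digraph" where
  "PIS R = \<lparr>pverts = nontrivial_ideals R,
     parcs = {(I, J). I \<in> nontrivial_ideals R \<and> J \<in> nontrivial_ideals R \<and> I \<noteq> J \<and>
                primeideal (I <+>\<^bsub>R\<^esub> J) R}\<rparr>"

lemma (in cring) PIS_bidirected: "pair_bidirected_digraph (PIS R)"
proof -
  have comm: "I <+>\<^bsub>R\<^esub> J = J <+>\<^bsub>R\<^esub> I"
    if "I \<in> nontrivial_ideals R" "J \<in> nontrivial_ideals R" for I J
  proof -
    have "I \<subseteq> carrier R" "J \<subseteq> carrier R"
      using that additive_subgroup.a_subset ideal.axioms(1)
      unfolding nontrivial_ideals_def by blast+
    then show ?thesis
      unfolding set_add_def' by (auto simp: subset_iff) (metis a_comm)+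
  qed
  have "sym (parcs (PIS R))"
    unfolding sym_def PIS_def by (auto simp: comm)
  then show ?thesis
    by unfold_locales (auto simp: PIS_def symmetric_def)
qed

end

theory Submission
  imports Defs
begin

text \<open>The prime ideal sum graph has diameter two. In such a graph a vertex w other than u and v
  strongly resolves u and v iff u and v are adjacent and exactly one of them is adjacent to w. Hence
  the complement of a strong resolving set is a clique, and sdim is the number of vertices minus the
  size of a largest clique, as soon as some largest clique contains no two vertices with the same
  closed neighbourhood.

  An ideal I of R is a tuple of ideals I i of the chain rings R i. Two ideals are adjacent iff there
  is exactly one index i at which both components are proper, and one of these two components is the
  maximal ideal M i. So the supports (the sets of indices with a proper component) of the members of
  a clique pairwise meet in a single index, and by the de Bruijn--Erdos theorem there are at most n
  of them, except that the support {i} may occur twice, once for M i. This gives the bound n + 1. It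
  is attained by the ideals with component M 0 at 0 and M j at j (for each j < n, including j = 0)
  together with the ideal whose only proper component is a nonzero ideal other than M 0 at 0.\<close>

section \<open>Strong metric dimension of graphs of diameter at most two\<close>

definition clique :: "'a pair_pre_digraph \<Rightarrow> 'a set \<Rightarrow> bool" where
  "clique G T \<longleftrightarrow> T \<subseteq> pverts G \<and> (\<forall>u\<in>T. \<forall>v\<in>T. u \<noteq> v \<longrightarrow> (u, v) \<in> parcs G)"

text \<open>In a graph of diameter at most two, \<open>w\<close> then has distance one from one of
  \<open>u\<close> and \<open>v\<close> and distance two from the other. If \<open>u\<close> and
  \<open>v\<close> are adjacent, their edge therefore starts a shortest path to
  \<open>w\<close>.\<close>

definition separates :: "'a pair_pre_digraph \<Rightarrow> 'a \<Rightarrow> 'a \<Rightarrow> 'a \<Rightarrow> bool" where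
  "separates G w u v \<longleftrightarrow>
     w \<in> pverts G \<and> w \<noteq> u \<and> w \<noteq> v \<and> ((u, w) \<in> parcs G \<longleftrightarrow> (v, w) \<notin> parcs G)"

text \<open>Two is only an upper bound for the diameter: complete graphs are included.\<close>

locale diameter_two_graph = pair_bidirected_digraph +
  assumes common_neighbour:
    "\<lbrakk>u \<in> pverts G; v \<in> pverts G; u \<noteq> v; (u, v) \<notin> parcs G\<rbrakk>
      \<Longrightarrow> \<exists>w. (u, w) \<in> parcs G \<and> (w, v) \<in> parcs G"
begin

section \<open>Arcs and shortest paths\<close>

lemma arc_sym: "(u, v) \<in> parcs G \<Longrightarrow> (v, u) \<in> parcs G"
  using pair_sym_arcs by (auto simp: symmetric_def dest: symD)

lemma arc_irrefl: "(u, u) \<notin> parcs G"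
  using pair_no_loops by fastforce

lemma apath_iff: "apath u p v \<longleftrightarrow>
    u \<in> pverts G \<and> set p \<subseteq> parcs G \<and> pcas u p v \<and> distinct (pawalk_verts u p)"
  unfolding apath_def awalk_def by simp

lemma shortest_path_arc:
  assumes "(u, v) \<in> parcs G"
  shows "shortest_path G u [(u, v)] v"
proof -
  have "u \<noteq> v"
    using assms arc_irrefl by auto
  moreover from this have "q \<noteq> []" if "apath u q v" for q
    using that by (auto simp: apath_iff)
  ultimately show ?thesis
    using assms wellformed' unfolding shortest_path_def
    by (auto simp: apath_iff Suc_le_eq)
qed

lemma shortest_path_two_arcs:
  assumes "(u, w) \<in> parcs G" "(w, v) \<in> parcs G" "u \<noteq> v" "(u, v) \<notin> parcs G"
  shows "shortest_path G u [(u, w), (w, v)] v"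
proof -
  have "u \<noteq> w" "w \<noteq> v"
    using assms arc_irrefl by auto
  then have "apath u [(u, w), (w, v)] v"
    using assms wellformed' by (auto simp: apath_iff)
  moreover have "length [(u, w), (w, v)] \<le> length q" if "apath u q v" for q
  proof (cases q)
    case Nil
    then show ?thesis using that assms by (auto simp: apath_iff)
  next
    case (Cons e es)
    then show ?thesis using that assms by (cases es) (auto simp: apath_iff)
  qed
  ultimately show ?thesis
    unfolding shortest_path_def by simp
qed

text \<open>The length bound serves to limit every other shortest path between the same ends; the
  membership of \<open>v\<close> is what resolving a pair by one of its own members
  requires.\<close>

lemma shortest_path_exists:
  assumes "u \<in> pverts G" "v \<in> pverts G" "u \<noteq> v"
  obtains p where "shortest_path G u p v" "length p \<le> 2" "v \<in> set (pawalk_verts u p)"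
proof (cases "(u, v) \<in> parcs G")
  case True
  show ?thesis
    by (rule that[OF shortest_path_arc[OF True]]) auto
next
  case False
  then obtain w where w: "(u, w) \<in> parcs G" "(w, v) \<in> parcs G"
    using common_neighbour assms by blast
  show ?thesis
    by (rule that[OF shortest_path_two_arcs[OF w assms(3) False]]) auto
qed

section \<open>Strong resolution expressed by adjacency\<close>

lemma strongly_resolves_commute: "strongly_resolves G w u v \<longleftrightarrow> strongly_resolves G w v u"
  unfolding strongly_resolves_def by blast

text \<open>A shortest path contains its own end. Hence a pair with a member in \<open>S\<close> is
  resolved by that member, and only pairs outside \<open>S\<close> impose a condition.\<close>

lemma strongly_resolves_self:
  assumes "u \<in> pverts G" "v \<in> pverts G" "u \<noteq> v"
  shows "strongly_resolves G v u v" "strongly_resolves G u u v"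
proof -
  have *: "strongly_resolves G b a b" if ab: "a \<in> pverts G" "b \<in> pverts G" "a \<noteq> b" for a b
  proof -
    obtain p where "shortest_path G a p b" "b \<in> set (pawalk_verts a p)"
      using shortest_path_exists[OF ab] by blast
    then show ?thesis
      unfolding strongly_resolves_def by auto
  qed
  show "strongly_resolves G v u v" "strongly_resolves G u u v"
    using *[of u v] *[of v u] assms strongly_resolves_commute by auto
qed

text \<open>If \<open>b\<close> is a neighbour of \<open>w\<close> and \<open>a\<close> is not, then
  the path through \<open>a\<close>, \<open>b\<close>, \<open>w\<close> is a shortest one.\<close>

lemma separates_imp_strongly_resolves:
  assumes "(u, v) \<in> parcs G" "separates G w u v"
  shows "strongly_resolves G w u v"
proof -
  have *: "strongly_resolves G w a b"
    if "(a, b) \<in> parcs G" "(b, w) \<in> parcs G" "w \<noteq> a" "(a, w) \<notin> parcs G" for a b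
    unfolding strongly_resolves_def
    using shortest_path_two_arcs[OF that(1,2)] that by auto
  show ?thesis
    using assms * arc_sym strongly_resolves_commute unfolding separates_def by metis
qed

text \<open>A shortest path has at most two arcs, so a vertex on it other than its two ends is the
  middle one and is reached from the start by a single arc.\<close>

lemma strongly_resolves_imp_adjacent:
  assumes "strongly_resolves G w u v" "u \<in> pverts G" "v \<in> pverts G" "w \<in> pverts G"
    "u \<noteq> v" "w \<noteq> u" "w \<noteq> v"
  shows "(u, v) \<in> parcs G"
proof -
  have *: "(a, b) \<in> parcs G"
    if p: "shortest_path G a p w" "b \<in> set (pawalk_verts a p)"
      and ab: "a \<in> pverts G" "a \<noteq> b" "w \<noteq> a" "w \<noteq> b" for a b p
  proof -
    obtain q where "shortest_path G a q w" "length q \<le> 2"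
      using shortest_path_exists[of a w] ab assms(4) by blast
    then have "length p \<le> 2"
      using p(1) unfolding shortest_path_def by (meson order_trans)
    moreover have "a \<in> pverts G" "set p \<subseteq> parcs G" "pcas a p w"
      using p(1) unfolding shortest_path_def by (auto simp: apath_iff)
    ultimately show ?thesis
      using p(2) ab by (cases p; cases "tl p") auto
  qed
  show ?thesis
    using assms * arc_sym unfolding strongly_resolves_def by (metis awalk_verts_with_proj_eq)
qed

text \<open>A resolver of two vertices outside \<open>S\<close> lies in \<open>S\<close>, so it
  differs from both, and this forces them to be adjacent.\<close>

lemma complement_of_strong_resolving_set:
  assumes "strong_resolving_set G S"
  shows "clique G (pverts G - S)"
  using assms strongly_resolves_imp_adjacent
  unfolding strong_resolving_set_def clique_def by (metis DiffD1 DiffD2 Diff_subset subsetD)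

lemma strong_resolving_set_complement:
  assumes T: "clique G T"
    and sep: "\<And>u v. \<lbrakk>u \<in> T; v \<in> T; u \<noteq> v\<rbrakk> \<Longrightarrow> \<exists>w. separates G w u v"
  shows "strong_resolving_set G (pverts G - T)"
  unfolding strong_resolving_set_def
proof (intro conjI ballI impI)
  fix u v assume uv: "u \<in> pverts G" "v \<in> pverts G" "u \<noteq> v"
  show "\<exists>w\<in>pverts G - T. strongly_resolves G w u v"
  proof (cases "u \<in> T \<and> v \<in> T")
    case True
    then obtain w where w: "separates G w u v"
      using sep uv by blast
    \<comment> \<open>A member of the clique other than \<open>u\<close> and \<open>v\<close> is
      adjacent to both and cannot separate them.\<close>
    have "w \<notin> T"
      using w T True arc_sym unfolding separates_def clique_def by blast
    then show ?thesis
      using w T True uv separates_imp_strongly_resolves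
      unfolding separates_def clique_def by blast
  next
    case False
    then show ?thesis
      using strongly_resolves_self uv by blast
  qed
qed auto

text \<open>Removing \<open>T\<close> leaves a strong resolving set of the claimed size. Conversely,
  the vertices left out by any strong resolving set form a clique, which is no larger than
  \<open>T\<close>. Separation is demanded for the one clique \<open>T\<close>, maximality against
  all cliques.\<close>

lemma sdim_eq:
  assumes fin: "finite (pverts G)"
    and T: "clique G T"
    and sep: "\<And>u v. \<lbrakk>u \<in> T; v \<in> T; u \<noteq> v\<rbrakk> \<Longrightarrow> \<exists>w. separates G w u v"
    and max: "\<And>T'. clique G T' \<Longrightarrow> card T' \<le> card T"
  shows "sdim G = card (pverts G) - card T"
  unfolding sdim_def
proof (rule Least_equality)
  have "T \<subseteq> pverts G"
    using T unfolding clique_def by blast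
  then show "\<exists>S. strong_resolving_set G S \<and> finite S \<and> card S = card (pverts G) - card T"
    using strong_resolving_set_complement[OF T sep] fin
    by (metis card_Diff_subset finite_Diff finite_subset)
next
  fix k assume "\<exists>S. strong_resolving_set G S \<and> finite S \<and> card S = k"
  then obtain S where S: "strong_resolving_set G S" "finite S" "card S = k"
    by blast
  then have "card (pverts G - S) = card (pverts G) - k"
    by (simp add: card_Diff_subset strong_resolving_set_def)
  then show "card (pverts G) - card T \<le> k"
    using max[OF complement_of_strong_resolving_set[OF S(1)]] by linarith
qed

end


section \<open>Sets pairwise meeting in one point\<close>

text \<open>The de Bruijn--Erdos theorem in dual form, by Conway's weighted double count of the pairs
  (x, t) with x not in A t.\<close>

lemma card_le_if_pairwise_meet_once:
  fixes A :: "'t \<Rightarrow> 'x set"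
  assumes fin: "finite T" "finite U"
    and sub: "\<And>t. t \<in> T \<Longrightarrow> A t \<subseteq> U"
    and ne: "\<And>t. t \<in> T \<Longrightarrow> A t \<noteq> {}"
    and meets: "\<And>s t. \<lbrakk>s \<in> T; t \<in> T; s \<noteq> t\<rbrakk> \<Longrightarrow> card (A s \<inter> A t) = 1"
    and avoid: "\<And>x. x \<in> U \<Longrightarrow> \<exists>t\<in>T. x \<notin> A t"
  shows "card T \<le> card U"
proof (rule ccontr)
  assume "\<not> card T \<le> card U"
  then have less: "card U < card T" by simp
  then have "T \<noteq> {}" by auto
  then obtain t0 where "t0 \<in> T" by blast
  then have "U \<noteq> {}" using sub[of t0] ne[of t0] by blast
  define d where "d x = card {t \<in> T. x \<in> A t}" for x
  have d_less: "d x < card T" if "x \<in> U" for x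
    unfolding d_def using avoid[OF that] fin by (intro psubset_card_mono) auto
  have fin_A: "finite (A t)" if "t \<in> T" for t
    using that sub fin finite_subset by blast
  have a_pos: "0 < card (A t)" if "t \<in> T" for t
    using that ne fin_A by (simp add: card_gt_0_iff)
  \<comment> \<open>If \<open>A t\<close> were all of \<open>U\<close>, another member
    \<open>A s\<close> would be a singleton \<open>{y}\<close>, and a member avoiding
    \<open>y\<close> could not meet it.\<close>
  have a_less: "card (A t) < card U" if t: "t \<in> T" for t
  proof (rule psubset_card_mono[OF fin(2) psubsetI[OF sub[OF t]]], rule notI)
    assume U: "A t = U"
    obtain x s where s: "s \<in> T" "x \<in> U" "x \<notin> A s"
      using avoid \<open>U \<noteq> {}\<close> by blast
    then have "A s \<inter> A t = A s" "s \<noteq> t"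
      using U sub by auto
    then obtain y where y: "A s = {y}"
      using meets[OF s(1) t] by (metis card_1_singletonE)
    then have "y \<in> U"
      using sub s by auto
    then obtain u where "u \<in> T" "y \<notin> A u"
      using avoid by blast
    then show False
      using y meets[of u s] s by (cases "u = s") auto
  qed
  \<comment> \<open>Each member through \<open>x\<close> is sent to its unique common point with
    \<open>A t\<close>. Two members with the same image would share that point and also
    \<open>x\<close>, which is a different point because it is not in \<open>A t\<close>.\<close>
  have d_le: "d x \<le> card (A t)" if t: "t \<in> T" and x: "x \<notin> A t" for x t
  proof -
    have "\<exists>y. A s \<inter> A t = {y}" if "s \<in> T" "x \<in> A s" for s
      using meets[of s t] that t x by (cases "s = t") (auto simp: card_1_singleton_iff)
    then have "\<forall>s\<in>{s \<in> T. x \<in> A s}. \<exists>y. A s \<inter> A t = {y}" by simp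
    from bchoice[OF this] obtain f
      where f: "\<And>s. s \<in> T \<Longrightarrow> x \<in> A s \<Longrightarrow> A s \<inter> A t = {f s}"
      by auto
    have "inj_on f {s \<in> T. x \<in> A s}"
    proof (rule inj_onI, rule ccontr)
      fix r s assume *: "r \<in> {s \<in> T. x \<in> A s}" "s \<in> {s \<in> T. x \<in> A s}" "f r = f s" "r \<noteq> s"
      then have "{x, f s} \<subseteq> A r \<inter> A s" "f s \<noteq> x"
        using f[of r] f[of s] x by auto
      then have "2 \<le> card (A r \<inter> A s)"
        using fin_A[of r] * card_mono[of "A r \<inter> A s" "{x, f s}"] by auto
      then show False
        using meets * by auto
    qed
    moreover have "f ` {s \<in> T. x \<in> A s} \<subseteq> A t"
      using f by auto
    ultimately show ?thesis
      unfolding d_def using fin_A[OF t] by (rule card_inj_on_le)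
  qed
  let ?n = "real (card U)" and ?m = "real (card T)"
  have n_pos: "?n > 0" using \<open>U \<noteq> {}\<close> fin by (simp add: card_gt_0_iff)
  have m_pos: "?m > 0" using less by simp
  \<comment> \<open>Conway's two weights of a pair with \<open>x\<close> outside \<open>A t\<close>.
    Each sums to one over all such pairs, since there are \<open>?m - d x\<close> pairs for fixed
    \<open>x\<close> and \<open>?n - card (A t)\<close> for fixed \<open>t\<close>. A strict
    inequality in every term is therefore contradictory.\<close>
  have strict: "1 / (?n * (?m - d x)) < 1 / (?m * (?n - card (A t)))"
    if "x \<in> U" "t \<in> T" "x \<notin> A t" for x t
  proof -
    have "?n * d x \<le> ?n * card (A t)"
      using d_le[OF that(2,3)] n_pos by simp
    also have "\<dots> < ?m * card (A t)"
      using less a_pos[OF that(2)] by simp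
    finally have "?m * (?n - card (A t)) < ?n * (?m - d x)"
      by (simp add: algebra_simps)
    moreover have "0 < ?m * (?n - card (A t))"
      using m_pos a_less[OF that(2)] by simp
    ultimately show ?thesis
      by (intro divide_strict_left_mono) auto
  qed
  let ?P = "SIGMA x:U. {t \<in> T. x \<notin> A t}"
  have "finite ?P" using fin by auto
  obtain x t where "x \<in> U" "t \<in> T" "x \<notin> A t"
    using \<open>U \<noteq> {}\<close> avoid by blast
  then have "?P \<noteq> {}" by auto
  have "(\<Sum>(x, t)\<in>?P. 1 / (?n * (?m - d x))) < (\<Sum>(x, t)\<in>?P. 1 / (?m * (?n - card (A t))))"
    using strict by (intro sum_strict_mono[OF \<open>finite ?P\<close> \<open>?P \<noteq> {}\<close>]) auto
  moreover have "(\<Sum>(x, t)\<in>?P. 1 / (?n * (?m - d x))) = 1"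
  proof -
    have "(\<Sum>(x, t)\<in>?P. 1 / (?n * (?m - d x))) = (\<Sum>x\<in>U. \<Sum>t\<in>{t \<in> T. x \<notin> A t}. 1 / (?n * (?m - d x)))"
      using fin by (intro sum.Sigma[symmetric]) auto
    also have "\<dots> = (\<Sum>x\<in>U. 1 / ?n)"
    proof (rule sum.cong[OF refl])
      fix x assume x: "x \<in> U"
      have "{t \<in> T. x \<notin> A t} = T - {t \<in> T. x \<in> A t}" by auto
      then have "real (card {t \<in> T. x \<notin> A t}) = ?m - d x"
        using fin d_less[OF x] unfolding d_def by (simp add: card_Diff_subset of_nat_diff)
      then show "(\<Sum>t\<in>{t \<in> T. x \<notin> A t}. 1 / (?n * (?m - d x))) = 1 / ?n"
        using d_less[OF x] by simp
    qed
    finally show ?thesis using n_pos by simp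
  qed
  moreover have "(\<Sum>(x, t)\<in>?P. 1 / (?m * (?n - card (A t)))) = 1"
  proof -
    have "(\<Sum>(x, t)\<in>?P. 1 / (?m * (?n - card (A t)))) =
        (\<Sum>x\<in>U. \<Sum>t\<in>{t \<in> T. x \<notin> A t}. 1 / (?m * (?n - card (A t))))"
      using fin by (intro sum.Sigma[symmetric]) auto
    also have "\<dots> = (\<Sum>t\<in>T. \<Sum>x\<in>{x \<in> U. x \<notin> A t}. 1 / (?m * (?n - card (A t))))"
      using fin by (intro sum.swap_restrict) auto
    also have "\<dots> = (\<Sum>t\<in>T. 1 / ?m)"
    proof (rule sum.cong[OF refl])
      fix t assume t: "t \<in> T"
      have "{x \<in> U. x \<notin> A t} = U - A t" by auto
      then have "real (card {x \<in> U. x \<notin> A t}) = ?n - card (A t)"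
        using fin_A[OF t] sub[OF t] a_less[OF t] by (simp add: card_Diff_subset of_nat_diff)
      then show "(\<Sum>x\<in>{x \<in> U. x \<notin> A t}. 1 / (?m * (?n - card (A t)))) = 1 / ?m"
        using a_less[OF t] by simp
    qed
    finally show ?thesis using m_pos by simp
  qed
  ultimately show False by simp
qed

text \<open>The flag b allows two members of the family to share the same support.\<close>

lemma card_le_Suc_if_pairwise_meet_once:
  fixes A :: "'t \<Rightarrow> 'x set" and b :: "'t \<Rightarrow> bool"
  assumes fin: "finite T" "finite U"
    and sub: "\<And>t. t \<in> T \<Longrightarrow> A t \<subseteq> U"
    and ne: "\<And>t. t \<in> T \<Longrightarrow> A t \<noteq> {}"
    and meets: "\<And>s t. \<lbrakk>s \<in> T; t \<in> T; s \<noteq> t\<rbrakk> \<Longrightarrow> card (A s \<inter> A t) = 1"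
    and flag: "\<And>s t. \<lbrakk>s \<in> T; t \<in> T; s \<noteq> t; A s = A t\<rbrakk> \<Longrightarrow> b s \<noteq> b t"
  shows "card T \<le> Suc (card U)"
\<comment> \<open>Without a common point the preceding bound applies. With a common point
  \<open>x\<close>, at most two members equal \<open>{x}\<close> by the flag, and the others are
  disjoint apart from \<open>x\<close>, so distinct points of \<open>U - {x}\<close> represent them:
  2 + (\<open>card U\<close> - 1) in total.\<close>
proof (cases "\<exists>x\<in>U. \<forall>t\<in>T. x \<in> A t")
  case False
  then have "card T \<le> card U"
    by (intro card_le_if_pairwise_meet_once[OF fin sub ne meets]) auto
  then show ?thesis by simp
next
  case True
  then obtain x where x: "x \<in> U" "\<And>t. t \<in> T \<Longrightarrow> x \<in> A t" by blast
  let ?T1 = "{t \<in> T. A t = {x}}" and ?T2 = "{t \<in> T. A t \<noteq> {x}}"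
  have "card ?T1 \<le> card (UNIV :: bool set)"
    using flag by (intro card_inj_on_le[of b]) (auto intro!: inj_onI)
  then have T1: "card ?T1 \<le> 2" by simp
  have "\<forall>t\<in>?T2. \<exists>y. y \<in> A t \<and> y \<noteq> x"
    using x(2) by blast
  from bchoice[OF this] obtain f where f: "\<And>t. t \<in> ?T2 \<Longrightarrow> f t \<in> A t \<and> f t \<noteq> x"
    by auto
  have "card ?T2 \<le> card (U - {x})"
  proof (rule card_inj_on_le)
    show "inj_on f ?T2"
    proof (rule inj_onI, rule ccontr)
      fix s t assume *: "s \<in> ?T2" "t \<in> ?T2" "f s = f t" "s \<noteq> t"
      then have sub': "{x, f s} \<subseteq> A s \<inter> A t"
        using f[of s] f[of t] x by auto
      have "card (A s \<inter> A t) = 1" using * meets by blast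
      then obtain y where "A s \<inter> A t = {y}" by (metis card_1_singletonE)
      then show False
        using f[OF *(1)] sub' by auto
    qed
    show "f ` ?T2 \<subseteq> U - {x}" using f sub by blast
  qed (use fin in auto)
  also have "\<dots> = card U - 1" using x fin by simp
  finally have T2: "card ?T2 \<le> card U - 1" .
  have "0 < card U" using x fin by (auto simp: card_gt_0_iff)
  have "T = ?T1 \<union> ?T2" by auto
  then have "card T \<le> card ?T1 + card ?T2" by (metis card_Un_le)
  then show ?thesis using T1 T2 \<open>0 < card U\<close> by linarith
qed


section \<open>Graphs of tuples\<close>

text \<open>In the application, comp J i is the i-th component of the ideal J, L i is the set of ideals of
  the i-th factor, top i, m i and zero i are its unit, maximal and zero ideals, and k i is any
  further ideal.\<close>

locale tuple_graph = pair_bidirected_digraph G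
  for G :: "'v pair_pre_digraph" +
  fixes n :: nat and L :: "nat \<Rightarrow> 'c set" and comp :: "'v \<Rightarrow> nat \<Rightarrow> 'c"
    and top m k zero :: "nat \<Rightarrow> 'c"
  assumes two_le_n: "2 \<le> n"
    and finite_L: "i < n \<Longrightarrow> finite (L i)"
    and mem_L: "i < n \<Longrightarrow> top i \<in> L i" "i < n \<Longrightarrow> m i \<in> L i" "i < n \<Longrightarrow> k i \<in> L i"
    and distinct_L: "i < n \<Longrightarrow> m i \<noteq> top i" "i < n \<Longrightarrow> m i \<noteq> zero i"
      "i < n \<Longrightarrow> k i \<noteq> top i" "i < n \<Longrightarrow> k i \<noteq> m i" "i < n \<Longrightarrow> k i \<noteq> zero i"
    and comp_mem: "\<lbrakk>v \<in> pverts G; i < n\<rbrakk> \<Longrightarrow> comp v i \<in> L i"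
    and comp_inj: "\<lbrakk>u \<in> pverts G; v \<in> pverts G; \<And>i. i < n \<Longrightarrow> comp u i = comp v i\<rbrakk> \<Longrightarrow> u = v"
    and comp_not_top: "v \<in> pverts G \<Longrightarrow> \<exists>i<n. comp v i \<noteq> top i"
    and comp_surj: "\<lbrakk>\<And>i. i < n \<Longrightarrow> f i \<in> L i; \<exists>i<n. f i \<noteq> top i; \<exists>i<n. f i \<noteq> zero i\<rbrakk>
      \<Longrightarrow> \<exists>v\<in>pverts G. \<forall>i<n. comp v i = f i"
    and arc_iff: "\<lbrakk>u \<in> pverts G; v \<in> pverts G; u \<noteq> v\<rbrakk> \<Longrightarrow> (u, v) \<in> parcs G \<longleftrightarrow>
      (\<exists>i<n. comp u i \<noteq> top i \<and> comp v i \<noteq> top i \<and> (comp u i = m i \<or> comp v i = m i) \<and>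
        (\<forall>j<n. j \<noteq> i \<longrightarrow> comp u j = top j \<or> comp v j = top j))"
begin

section \<open>Supports and adjacency\<close>

definition supp :: "'v \<Rightarrow> nat set" where
  "supp v = {i. i < n \<and> comp v i \<noteq> top i}"

lemma supp_ne: "v \<in> pverts G \<Longrightarrow> supp v \<noteq> {}"
  using comp_not_top unfolding supp_def by blast

text \<open>Brings adjacency into the form to which the bounds on sets meeting in one point
  apply.\<close>

lemma arc_iff_supp:
  assumes "u \<in> pverts G" "v \<in> pverts G" "u \<noteq> v"
  shows "(u, v) \<in> parcs G \<longleftrightarrow> (\<exists>i. supp u \<inter> supp v = {i} \<and> (comp u i = m i \<or> comp v i = m i))"
proof -
  have "supp u \<inter> supp v = {i} \<longleftrightarrow> i < n \<and> comp u i \<noteq> top i \<and> comp v i \<noteq> top i \<and>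
      (\<forall>j<n. j \<noteq> i \<longrightarrow> comp u j = top j \<or> comp v j = top j)" for i
    unfolding supp_def by auto
  then show ?thesis
    using arc_iff[OF assms] by auto
qed

lemma finite_pverts: "finite (pverts G)"
\<comment> \<open>\<open>restrict\<close> fixes the values beyond the index range, about which
  nothing is known for \<open>comp\<close>, so that the images lie in a finite product.\<close>
proof (rule inj_on_finite[of "\<lambda>v. restrict (comp v) {..<n}"])
  show "inj_on (\<lambda>v. restrict (comp v) {..<n}) (pverts G)"
    by (rule inj_onI, rule comp_inj) (auto dest: fun_cong simp: restrict_def split: if_splits)
  show "(\<lambda>v. restrict (comp v) {..<n}) ` pverts G \<subseteq> PiE {..<n} L"
    using comp_mem by (auto simp: PiE_iff split: if_splits)
  show "finite (PiE {..<n} L)"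
    using finite_L by (intro finite_PiE) auto
qed

text \<open>The indices may coincide, and then the support is the singleton \<open>{i}\<close>.
  These vertices supply the common neighbours, most of the extremal clique and most of the
  separating vertices.\<close>

lemma obtain_edge_vertex:
  assumes "i < n" "j < n"
  obtains w where "w \<in> pverts G" "supp w = {i, j}" "comp w i = m i" "comp w j = m j"
proof -
  let ?f = "\<lambda>l. if l = i \<or> l = j then m l else top l"
  have "\<exists>v\<in>pverts G. \<forall>l<n. comp v l = ?f l"
  proof (rule comp_surj)
    show "\<exists>l<n. ?f l \<noteq> top l" "\<exists>l<n. ?f l \<noteq> zero l"
      using assms(1) distinct_L[of i] by (auto intro!: exI[of _ i])
  qed (use mem_L in auto)
  then obtain w where "w \<in> pverts G" "\<And>l. l < n \<Longrightarrow> comp w l = ?f l"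
    by auto
  moreover from this have "supp w = {i, j}"
    using assms distinct_L unfolding supp_def by (auto split: if_splits)
  ultimately show ?thesis
    using assms that by auto
qed

text \<open>For disjoint supports, a vertex supported on one index from each is a common neighbour.
  If the supports share an index \<open>i\<close>, the vertex with support \<open>{i}\<close> and
  component \<open>m i\<close> is one.\<close>

lemma diameter_two: "diameter_two_graph G"
proof unfold_locales
  fix u v assume uv: "u \<in> pverts G" "v \<in> pverts G" "u \<noteq> v" "(u, v) \<notin> parcs G"
  show "\<exists>w. (u, w) \<in> parcs G \<and> (w, v) \<in> parcs G"
  proof (cases "supp u \<inter> supp v = {}")
    case True
    obtain i j where ij: "i \<in> supp u" "j \<in> supp v"
      using supp_ne uv by blast
    then have "i < n" "j < n"
      unfolding supp_def by auto
    then obtain w where w: "w \<in> pverts G" "supp w = {i, j}" "comp w i = m i" "comp w j = m j"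
      using obtain_edge_vertex by metis
    have meets: "supp u \<inter> supp w = {i}" "supp w \<inter> supp v = {j}"
      using w ij True by auto
    moreover have "w \<noteq> u" "w \<noteq> v"
      using w ij True by auto
    ultimately show ?thesis
      using arc_iff_supp[of u w] arc_iff_supp[of w v] uv w by auto
  next
    case False
    then obtain i where i: "i \<in> supp u" "i \<in> supp v" by blast
    then have "i < n"
      unfolding supp_def by auto
    then obtain w where w: "w \<in> pverts G" "supp w = {i}" "comp w i = m i"
      using obtain_edge_vertex[of i i] by (metis insert_absorb2)
    have meets: "supp u \<inter> supp w = {i}" "supp w \<inter> supp v = {i}"
      using w i by auto
    \<comment> \<open>If \<open>w\<close> were \<open>u\<close> or \<open>v\<close>, the supports of
      \<open>u\<close> and \<open>v\<close> would meet exactly in \<open>i\<close> with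
      \<open>m i\<close> as one component, making \<open>u\<close> and \<open>v\<close>
      adjacent.\<close>
    moreover have "w \<noteq> u" "w \<noteq> v"
      using arc_iff_supp[of u v] meets w uv by auto
    ultimately show ?thesis
      using arc_iff_supp[of u w] arc_iff_supp[of w v] uv w by auto
  qed
qed

section \<open>Largest cliques of the tuple graph\<close>

lemma card_clique_le:
  assumes "clique G T"
  shows "card T \<le> n + 1"
proof -
  have T: "T \<subseteq> pverts G" and arc: "\<And>u v. \<lbrakk>u \<in> T; v \<in> T; u \<noteq> v\<rbrakk> \<Longrightarrow> (u, v) \<in> parcs G"
    using assms unfolding clique_def by auto
  have "card T \<le> Suc (card {..<n})"
  \<comment> \<open>The flag records whether some component is maximal. Adjacent vertices with equal
    supports have a singleton support \<open>{i}\<close>, and one of them has \<open>m i\<close>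
    there; with equal flags both would, and they would coincide.\<close>
  proof (rule card_le_Suc_if_pairwise_meet_once[where A = supp and b = "\<lambda>v. \<exists>i<n. comp v i = m i"])
    show "finite T" using T finite_pverts finite_subset by blast
    show "supp t \<subseteq> {..<n}" "supp t \<noteq> {}" if "t \<in> T" for t
      using that T supp_ne unfolding supp_def by auto
    show "card (supp s \<inter> supp t) = 1" if "s \<in> T" "t \<in> T" "s \<noteq> t" for s t
      using that arc[OF that] arc_iff_supp[of s t] T by (auto simp: subset_iff)
    show "(\<exists>i<n. comp s i = m i) \<noteq> (\<exists>i<n. comp t i = m i)"
      if st: "s \<in> T" "t \<in> T" "s \<noteq> t" "supp s = supp t" for s t
    proof
      assume eq: "(\<exists>i<n. comp s i = m i) = (\<exists>i<n. comp t i = m i)"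
      obtain i where i: "supp s = {i}" "comp s i = m i \<or> comp t i = m i"
        using arc_iff_supp[of s t] arc[OF st(1-3)] st T by (auto simp: subset_iff)
      then have "i < n" unfolding supp_def by auto
      \<comment> \<open>Since \<open>m j\<close> differs from \<open>top j\<close>, a maximal
        component can only occur inside the support, that is, at \<open>i\<close>.\<close>
      have m_iff: "(\<exists>j<n. comp v j = m j) \<longleftrightarrow> comp v i = m i" if "supp v = {i}" for v
      proof -
        have "j = i" if j: "j < n" "comp v j = m j" for j
        proof -
          have "j \<in> supp v"
            using j distinct_L(1)[OF j(1)] unfolding supp_def by simp
          then show ?thesis
            using \<open>supp v = {i}\<close> by simp
        qed
        then show ?thesis
          using \<open>i < n\<close> by metis
      qed
      have "comp s i = m i" "comp t i = m i"
        using eq i(2) m_iff[of s] m_iff[of t] i(1) st(4) by simp_all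
      moreover have "comp s j = top j" "comp t j = top j" if "j < n" "j \<noteq> i" for j
      proof -
        have "j \<notin> supp s" "j \<notin> supp t"
          using that(2) i(1) st(4) by auto
        then show "comp s j = top j" "comp t j = top j"
          using that(1) unfolding supp_def by auto
      qed
      ultimately have "comp s j = comp t j" if "j < n" for j
        using that by (cases "j = i") simp_all
      then show False
        using comp_inj st T by blast
    qed
  qed auto
  then show ?thesis by simp
qed

text \<open>All supports in the clique contain 0 and meet pairwise only there. Adjacency follows
  because \<open>c\<close> alone has a component other than \<open>m 0\<close> at this
  index.\<close>

lemma obtain_separated_clique:
  obtains T where "clique G T" "card T = n + 1"
    "\<And>u v. \<lbrakk>u \<in> T; v \<in> T; u \<noteq> v\<rbrakk> \<Longrightarrow> \<exists>w. separates G w u v"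
proof -
  have "0 < n" "1 < n" using two_le_n by auto
  have "\<exists>w\<in>pverts G. supp w = {0, j} \<and> comp w 0 = m 0 \<and> comp w j = m j" if "j < n" for j
    using that obtain_edge_vertex[of 0 j] by (metis \<open>0 < n\<close>)
  \<comment> \<open>For \<open>j = 0\<close> the support collapses to \<open>{0}\<close>, so
    \<open>e 0\<close> and \<open>c\<close> are the one pair with equal supports.\<close>
  then obtain e where e: "\<And>j. j < n \<Longrightarrow> e j \<in> pverts G" "\<And>j. j < n \<Longrightarrow> supp (e j) = {0, j}"
      "\<And>j. j < n \<Longrightarrow> comp (e j) 0 = m 0" "\<And>j. j < n \<Longrightarrow> comp (e j) j = m j"
    by metis
  have "\<exists>v\<in>pverts G. \<forall>l<n. comp v l = (if l = 0 then k l else top l)"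
    using mem_L distinct_L \<open>0 < n\<close> by (intro comp_surj) auto
  then obtain c where c: "c \<in> pverts G" "\<And>l. l < n \<Longrightarrow> comp c l = (if l = 0 then k l else top l)"
    by auto
  have supp_c: "supp c = {0}"
    using c distinct_L \<open>0 < n\<close> unfolding supp_def by (auto split: if_splits)
  have comp_c: "comp c 0 = k 0" "k 0 \<noteq> m 0"
    using c distinct_L \<open>0 < n\<close> by auto
  have e_ne: "e i \<noteq> e j" if "i < n" "j < n" "i \<noteq> j" for i j
    using e(2)[OF that(1)] e(2)[OF that(2)] that(3) by (auto simp: doubleton_eq_iff)
  have c_ne: "c \<noteq> e j" if "j < n" for j
    using e(3)[OF that] comp_c by auto
  let ?T = "insert c (e ` {..<n})"
  have "inj_on e {..<n}"
    using e_ne by (auto intro!: inj_onI)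
  then have "card (e ` {..<n}) = n"
    by (simp add: card_image)
  then have card: "card ?T = n + 1"
    using c_ne by (subst card_insert_disjoint) auto
  have arc_ee: "(e i, e j) \<in> parcs G" if "i < n" "j < n" "i \<noteq> j" for i j
  proof -
    have "supp (e i) \<inter> supp (e j) = {0}"
      using e(2) that by auto
    then show ?thesis
      using arc_iff_supp[of "e i" "e j"] e e_ne that by auto
  qed
  have arc_ce: "(c, e j) \<in> parcs G" "(e j, c) \<in> parcs G" if "j < n" for j
  proof -
    have *: "supp c \<inter> supp (e j) = {0}" "supp (e j) \<inter> supp c = {0}"
      using e(2)[OF that] supp_c by auto
    show "(c, e j) \<in> parcs G"
      using arc_iff_supp[of c "e j"] *(1) e that c_ne[OF that] c(1) by auto
    show "(e j, c) \<in> parcs G"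
      using arc_iff_supp[of "e j" c] *(2) e that c_ne[OF that] c(1) by auto
  qed
  have cl: "clique G ?T"
    unfolding clique_def using e(1) c(1) arc_ee arc_ce by auto
  have sep_commute: "\<exists>w. separates G w v u" if "\<exists>w. separates G w u v" for u v
    using that unfolding separates_def by auto
  \<comment> \<open>The vertex with support \<open>{j}\<close> and component \<open>m j\<close> is
    adjacent to \<open>e j\<close>, while its support is disjoint from that of
    \<open>v\<close>.\<close>
  have sep_e: "\<exists>w. separates G w v (e j)"
    if v: "v \<in> pverts G" and j: "j < n" "j \<noteq> 0" and "supp v \<inter> {j} = {}" for v j
  proof -
    obtain w where w: "w \<in> pverts G" "supp w = {j}" "comp w j = m j"
      using obtain_edge_vertex[of j j] j by (metis insert_absorb2)
    have "supp (e j) \<inter> supp w = {j}" "w \<noteq> e j" "supp v \<inter> supp w = {}" "w \<noteq> v"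
      using w e(2)[OF j(1)] j that by auto
    then show ?thesis
      unfolding separates_def
      using arc_iff_supp[of v w] arc_iff_supp[of "e j" w] w v e(1)[OF j(1)] by auto
  qed
  \<comment> \<open>Supports cannot tell \<open>c\<close> from \<open>e 0\<close>, so the component
    at 0 has to. With \<open>k 0\<close> there, \<open>w\<close> is adjacent to \<open>e 0\<close>
    but not to \<open>c\<close>, whose component is also \<open>k 0\<close>; the further index 1
    makes \<open>w\<close> different from \<open>c\<close>.\<close>
  have sep_c: "\<exists>w. separates G w c (e 0)"
  proof -
    let ?f = "\<lambda>l. if l = 0 then k l else if l = 1 then m l else top l"
    have "\<exists>v\<in>pverts G. \<forall>l<n. comp v l = ?f l"
      using mem_L distinct_L \<open>0 < n\<close> by (intro comp_surj) auto
    then obtain w where w: "w \<in> pverts G" "\<And>l. l < n \<Longrightarrow> comp w l = ?f l"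
      by auto
    have supp_w: "supp w = {0, 1}"
      using w distinct_L \<open>0 < n\<close> \<open>1 < n\<close> unfolding supp_def by (auto split: if_splits)
    have "supp c \<inter> supp w = {0}" "supp (e 0) \<inter> supp w = {0}" "w \<noteq> c" "w \<noteq> e 0" "comp w 0 = k 0"
      using supp_w supp_c e(2)[OF \<open>0 < n\<close>] w(2)[OF \<open>0 < n\<close>] by auto
    then show ?thesis
      unfolding separates_def
      using arc_iff_supp[of c w] arc_iff_supp[of "e 0" w] w c e[OF \<open>0 < n\<close>] comp_c by auto
  qed
  have sep_ce: "\<exists>w. separates G w c (e j)" if "j < n" for j
    using sep_c sep_e[OF c(1) that] supp_c by (cases "j = 0") auto
  have sep_ee: "\<exists>w. separates G w (e i) (e j)" if "i < n" "j < n" "i \<noteq> j" for i j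
  proof (cases "j = 0")
    case False
    then show ?thesis
      using sep_e[of "e i" j] e that by auto
  next
    case True
    then show ?thesis
      using sep_commute[OF sep_e[of "e j" i]] e that by auto
  qed
  have "\<exists>w. separates G w u v" if "u \<in> ?T" "v \<in> ?T" "u \<noteq> v" for u v
    using that sep_ce sep_commute[OF sep_ce] sep_ee by (auto; metis)
  then show ?thesis
    using that cl card by blast
qed

text \<open>The second fact shows that the subtraction of natural numbers is not truncated, as the
  passage to integers requires.\<close>

theorem sdim_tuple_graph:
  "sdim G = card (pverts G) - (n + 1)" "n + 1 \<le> card (pverts G)"
proof -
  interpret diameter_two_graph G
    by (rule diameter_two)
  obtain T where T: "clique G T" "card T = n + 1"
    "\<And>u v. \<lbrakk>u \<in> T; v \<in> T; u \<noteq> v\<rbrakk> \<Longrightarrow> \<exists>w. separates G w u v"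
    using obtain_separated_clique by blast
  show "sdim G = card (pverts G) - (n + 1)"
    using sdim_eq[OF finite_pverts T(1,3)] card_clique_le T(2) by auto
  show "n + 1 \<le> card (pverts G)"
    using T(1,2) finite_pverts card_mono unfolding clique_def by metis
qed

end


section \<open>Artinian local principal ideal rings\<close>

text \<open>These are the Artinian chain rings: the ideals turn out to be the powers of the maximal
  ideal, the zero ideal included.\<close>

locale special_principal_ring = artinian_ring + local_ring + principal_ideal_ring
begin

lemma ideal_principal:
  assumes "ideal I R"
  obtains a where "a \<in> carrier R" "I = PIdl a"
  using principalideal.generate[OF all_principal[OF assms]] cgenideal_eq_genideal by metis

lemma ideal_eq_carrier_iff: "ideal I R \<Longrightarrow> I = carrier R \<longleftrightarrow> \<one> \<in> I"
  using ideal.one_imp_carrier one_closed by metis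

definition max_ideal :: "'a set" where
  "max_ideal = (THE M. maximalideal M R)"

lemma maximalideal_iff: "maximalideal M R \<longleftrightarrow> M = max_ideal"
  unfolding max_ideal_def using unique_maximalideal theI' by (metis (no_types, lifting))

lemma max_ideal: "maximalideal max_ideal R" "ideal max_ideal R" "max_ideal \<noteq> carrier R"
proof -
  show max: "maximalideal max_ideal R"
    using maximalideal_iff by blast
  show "ideal max_ideal R"
    using max by (rule maximalideal.axioms(1))
  show "max_ideal \<noteq> carrier R"
    using maximalideal.I_notcarr[OF max] by simp
qed

text \<open>Zorn's lemma gives a maximal ideal above \<open>I\<close>, and there is only one maximal
  ideal. Principal ideals make the ring Noetherian, so the union of a chain of proper ideals belongs
  to the chain and is itself proper.\<close>

lemma proper_ideal_le_max_ideal: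
  assumes "ideal I R" "I \<noteq> carrier R"
  shows "I \<subseteq> max_ideal"
proof -
  interpret noetherian_ring R
  proof (rule noetherian_ringI)
    fix J assume "ideal J R"
    then obtain a where "a \<in> carrier R" "J = Idl {a}"
      using principalideal.generate all_principal by blast
    then show "\<exists>A\<subseteq>carrier R. finite A \<and> J = Idl A"
      by (intro exI[of _ "{a}"]) auto
  qed
  let ?F = "{J. ideal J R \<and> I \<subseteq> J \<and> J \<noteq> carrier R}"
  have "\<exists>M\<in>?F. \<forall>J\<in>?F. M \<subseteq> J \<longrightarrow> J = M"
  proof (rule subset_Zorn_nonempty)
    show "?F \<noteq> {}" using assms by blast
    fix C assume "C \<noteq> {}" and C: "subset.chain ?F C"
    have "\<Union>C \<in> C"
      using \<open>C \<noteq> {}\<close> C by (intro ideal_chain_is_trivial) (auto simp: subset_chain_def)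
    then show "\<Union>C \<in> ?F"
      using C by (auto simp: subset_chain_def)
  qed
  then obtain M where M: "M \<in> ?F" "\<forall>J\<in>?F. M \<subseteq> J \<longrightarrow> J = M" ..
  have "maximalideal M R"
  proof (rule maximalidealI)
    show "ideal M R" "carrier R \<noteq> M" using M(1) by auto
    show "J = M \<or> J = carrier R" if J: "ideal J R" "M \<subseteq> J" for J
    proof (rule disjCI)
      assume "J \<noteq> carrier R"
      then have "J \<in> ?F" using J M(1) by auto
      then show "J = M" using M(2) J(2) by blast
    qed
  qed
  then show ?thesis
    using M(1) maximalideal_iff by auto
qed

section \<open>Units, nilpotency and powers of the generator\<close>

lemma cgenideal_eq_carrier_if_not_in_max_ideal:
  assumes "x \<in> carrier R" "x \<notin> max_ideal"
  shows "PIdl x = carrier R"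
  using proper_ideal_le_max_ideal[OF cgenideal_ideal[OF assms(1)]] cgenideal_self[OF assms(1)] assms(2)
  by blast

text \<open>\<open>PIdl y = carrier R\<close> expresses that \<open>y\<close> is a unit, and
  associated elements generate the same ideal.\<close>

lemma cgenideal_unit_mult:
  assumes "y \<in> carrier R" "a \<in> carrier R" "PIdl y = carrier R"
  shows "PIdl (y \<otimes> a) = PIdl a"
proof
  obtain z where z: "z \<in> carrier R" "\<one> = z \<otimes> y"
    using assms(3) one_closed unfolding cgenideal_def by blast
  have "z \<otimes> (y \<otimes> a) = a"
    using z(1) assms by (simp add: m_assoc[symmetric] flip: z(2))
  then have "a \<in> PIdl (y \<otimes> a)"
    using z unfolding cgenideal_def by force
  then show "PIdl a \<subseteq> PIdl (y \<otimes> a)"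
    using assms by (intro cgenideal_minimal cgenideal_ideal) auto
  have "y \<otimes> a \<in> PIdl a"
    using assms unfolding cgenideal_def by blast
  then show "PIdl (y \<otimes> a) \<subseteq> PIdl a"
    using assms by (intro cgenideal_minimal cgenideal_ideal) auto
qed

lemma cgenideal_mult_subset:
  assumes "y \<in> carrier R" "a \<in> carrier R"
  shows "PIdl (y \<otimes> a) \<subseteq> PIdl a"
  using assms by (intro cgenideal_minimal cgenideal_ideal) (auto simp: cgenideal_def)

text \<open>The ideals of the powers of \<open>p\<close> become stationary, so some power satisfies
  \<open>p [^] k = r \<otimes> p [^] Suc k\<close>. Then
  \<open>\<one> \<ominus> r \<otimes> p\<close> annihilates \<open>p [^] k\<close>, and it is a unit
  because \<open>r \<otimes> p\<close> lies in the maximal ideal.\<close>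

lemma max_ideal_generator_nilpotent:
  assumes p: "p \<in> carrier R" "max_ideal = PIdl p"
  obtains k :: nat where "p [^] k = \<zero>"
proof -
  have "\<exists>k. \<forall>l\<ge>k. PIdl (p [^] l) = PIdl (p [^] (k :: nat))"
  proof (rule descending_chain[of "\<lambda>l. PIdl (p [^] l)"])
    show "ideal (PIdl (p [^] l)) R" for l :: nat
      using p by (simp add: cgenideal_ideal)
    show "PIdl (p [^] Suc l) \<subseteq> PIdl (p [^] l)" for l :: nat
      using cgenideal_mult_subset[of p "p [^] l"] p by (simp add: m_comm)
  qed
  then obtain k where "PIdl (p [^] Suc k) = PIdl (p [^] k)"
    by (meson le_SucI order_refl)
  then have "p [^] k \<in> PIdl (p [^] Suc k)"
    using cgenideal_self[of "p [^] k"] p by simp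
  then obtain r where r: "r \<in> carrier R" "p [^] k = r \<otimes> p [^] Suc k"
    unfolding cgenideal_def by blast
  let ?u = "\<one> \<ominus> r \<otimes> p"
  have u: "?u \<in> carrier R" using r p by simp
  have "?u \<notin> max_ideal"
  proof
    assume "?u \<in> max_ideal"
    moreover have "r \<otimes> p \<in> max_ideal"
      using r p unfolding cgenideal_def by blast
    ultimately have "?u \<oplus> r \<otimes> p \<in> max_ideal"
      using max_ideal(2) by (simp add: additive_subgroup.a_closed ideal.axioms(1))
    moreover have "?u \<oplus> r \<otimes> p = \<one>"
      using r p by algebra
    ultimately show False
      using ideal_eq_carrier_iff max_ideal by auto
  qed
  then have "PIdl (?u \<otimes> p [^] k) = PIdl (p [^] k)"
    using u p by (intro cgenideal_unit_mult cgenideal_eq_carrier_if_not_in_max_ideal) auto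
  moreover have "?u \<otimes> p [^] k = \<zero>"
  proof -
    have "?u \<otimes> p [^] k = p [^] k \<ominus> r \<otimes> (p [^] k \<otimes> p)"
      using r(1) p nat_pow_closed[OF p(1), of k] by algebra
    also have "\<dots> = \<zero>"
      using r p by (simp add: a_minus_def r_neg)
    finally show ?thesis .
  qed
  ultimately have "p [^] k \<in> PIdl \<zero>"
    using cgenideal_self[of "p [^] k"] p by simp
  then show ?thesis
    using that unfolding cgenideal_def by auto
qed

lemma ideal_eq_power:
  obtains p and k :: nat where "p \<in> carrier R" "max_ideal = PIdl p" "p [^] k = \<zero>"
    "\<And>I. ideal I R \<Longrightarrow> \<exists>j\<le>k. I = PIdl (p [^] j)"
proof -
  obtain p where p: "p \<in> carrier R" "max_ideal = PIdl p"
    using ideal_principal max_ideal(2) by blast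
  obtain k :: nat where k: "p [^] k = \<zero>"
    using max_ideal_generator_nilpotent[OF p] by blast
  \<comment> \<open>Factors \<open>p\<close> are split off from \<open>x\<close> one at a time until
    the cofactor is a unit. If this does not happen within \<open>k\<close> steps, then
    \<open>x\<close> is a multiple of \<open>p [^] k\<close>, hence zero.\<close>
  have *: "x \<in> PIdl (p [^] l) \<or> (\<exists>j<l. PIdl x = PIdl (p [^] j))" if x: "x \<in> carrier R" for x and l :: nat
  proof (induction l)
    case 0
    then show ?case
      using x unfolding cgenideal_def by force
  next
    case (Suc l)
    show ?case
    proof (cases "\<exists>j<l. PIdl x = PIdl (p [^] j)")
      case True
      then show ?thesis using less_SucI by blast
    next
      case False
      then obtain y where y: "y \<in> carrier R" "x = y \<otimes> p [^] l"
        using Suc unfolding cgenideal_def by blast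
      show ?thesis
      proof (cases "y \<in> max_ideal")
        case True
        then obtain z where "z \<in> carrier R" "y = z \<otimes> p"
          using p unfolding cgenideal_def by blast
        then have "x = z \<otimes> p [^] Suc l"
          using y p by (simp add: m_ac)
        then have "x \<in> PIdl (p [^] Suc l)"
          using \<open>z \<in> carrier R\<close> unfolding cgenideal_def by blast
        then show ?thesis ..
      next
        case False
        then have "PIdl x = PIdl (p [^] l)"
          using cgenideal_unit_mult[OF y(1) _ cgenideal_eq_carrier_if_not_in_max_ideal[OF y(1)]] y(2) p(1) by simp
        then have "\<exists>j<Suc l. PIdl x = PIdl (p [^] j)" by (intro exI[of _ l]) simp
        then show ?thesis ..
      qed
    qed
  qed
  have "\<exists>j\<le>k. I = PIdl (p [^] j)" if I: "ideal I R" for I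
  proof -
    obtain x where x: "x \<in> carrier R" "I = PIdl x"
      using ideal_principal[OF I] by blast
    show ?thesis
    proof (cases "x = \<zero>")
      case True
      then show ?thesis using k x(2) by (intro exI[of _ k]) simp
    next
      case False
      then have "x \<notin> PIdl (p [^] k)"
        using k unfolding cgenideal_def by auto
      then show ?thesis
        using *[OF x(1), of k] x(2) less_imp_le by blast
    qed
  qed
  then show ?thesis
    using that p k by blast
qed

lemma finite_ideals: "finite {I. ideal I R}"
proof -
  obtain p and k :: nat where "\<And>I. ideal I R \<Longrightarrow> \<exists>j\<le>k. I = PIdl (p [^] j)"
    using ideal_eq_power by metis
  then have "{I. ideal I R} \<subseteq> (\<lambda>j. PIdl (p [^] j)) ` {..k}"
    by auto
  then show ?thesis
    using finite_subset by blast
qed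

section \<open>Prime ideals and sums of ideals in a chain ring\<close>

lemma ideals_chain:
  assumes "ideal I R" "ideal J R"
  shows "I \<subseteq> J \<or> J \<subseteq> I"
proof -
  obtain p and k :: nat where p: "p \<in> carrier R"
    and pow: "\<And>I. ideal I R \<Longrightarrow> \<exists>j\<le>k. I = PIdl (p [^] j)"
    using ideal_eq_power by metis
  have "PIdl (p [^] (i + j)) \<subseteq> PIdl (p [^] j)" for i j :: nat
    using cgenideal_mult_subset[of "p [^] i" "p [^] j"] p by (simp add: nat_pow_mult)
  then have mono: "PIdl (p [^] i) \<subseteq> PIdl (p [^] j)" if "j \<le> i" for i j :: nat
    using that by (metis le_add_diff_inverse2)
  show ?thesis
    using pow[OF assms(1)] pow[OF assms(2)] mono by (metis nat_le_linear)
qed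

text \<open>A prime ideal contains the nilpotent generator \<open>p\<close> and hence the whole
  maximal ideal.\<close>

lemma primeideal_iff_max_ideal: "primeideal P R \<longleftrightarrow> P = max_ideal"
proof
  assume prime: "primeideal P R"
  then have P: "ideal P R" "P \<noteq> carrier R"
    using primeideal.axioms(1) primeideal.I_notcarr by blast+
  obtain p and k :: nat where p: "p \<in> carrier R" "max_ideal = PIdl p" "p [^] k = \<zero>"
    using ideal_eq_power by metis
  have "p [^] l \<in> P \<Longrightarrow> p \<in> P" for l :: nat
  proof (induction l)
    case 0
    then show ?case using P ideal_eq_carrier_iff by simp
  next
    case (Suc l)
    then show ?case
      using primeideal.I_prime[OF prime, of "p [^] l" p] p by auto
  qed
  then have "p \<in> P"
    using p(3) P(1) additive_subgroup.zero_closed ideal.axioms(1) by metis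
  then have "max_ideal \<subseteq> P"
    using p(2) P(1) cgenideal_minimal by simp
  then show "P = max_ideal"
    using proper_ideal_le_max_ideal[OF P] by blast
next
  assume "P = max_ideal"
  then show "primeideal P R"
    using maximalideal_prime max_ideal(1) by blast
qed

lemma set_add_eq_right:
  assumes "ideal I R" "ideal J R" "I \<subseteq> J"
  shows "I <+> J = J" "J <+> I = J"
proof -
  have I: "I \<subseteq> carrier R" "\<zero> \<in> I" and J: "J \<subseteq> carrier R"
    using assms(1,2) additive_subgroup.a_subset additive_subgroup.zero_closed ideal.axioms(1) by blast+
  have "I <+> J \<subseteq> J"
    using assms(2,3) unfolding set_add_def'
    by (auto intro!: additive_subgroup.a_closed ideal.axioms(1))
  moreover have "j \<in> I <+>\<^bsub>R\<^esub> J" if "j \<in> J" for j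
    using that I(2) J l_zero[of j] unfolding set_add_def' by force
  ultimately show "I <+> J = J" by blast
  then show "J <+> I = J"
    using set_add_comm I(1) J by simp
qed

lemma set_add_eq_carrier_iff:
  assumes "ideal I R" "ideal J R"
  shows "I <+> J = carrier R \<longleftrightarrow> I = carrier R \<or> J = carrier R"
proof -
  have "I \<subseteq> carrier R" "J \<subseteq> carrier R"
    using assms additive_subgroup.a_subset ideal.axioms(1) by blast+
  then show ?thesis
    using ideals_chain[OF assms] set_add_eq_right assms by auto
qed

text \<open>Ideals are comparable, so the sum is the larger summand. This is the source of the
  condition on the components of adjacent ideals.\<close>

lemma set_add_eq_max_ideal_iff:
  assumes "ideal I R" "ideal J R"
  shows "I <+> J = max_ideal \<longleftrightarrow>
    I \<noteq> carrier R \<and> J \<noteq> carrier R \<and> (I = max_ideal \<or> J = max_ideal)"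
proof -
  have sub: "I \<subseteq> carrier R" "J \<subseteq> carrier R"
    using assms additive_subgroup.a_subset ideal.axioms(1) by blast+
  have *: "A <+> B = max_ideal \<longleftrightarrow>
      A \<noteq> carrier R \<and> B \<noteq> carrier R \<and> (A = max_ideal \<or> B = max_ideal)"
    "B <+> A = max_ideal \<longleftrightarrow>
      B \<noteq> carrier R \<and> A \<noteq> carrier R \<and> (B = max_ideal \<or> A = max_ideal)"
    if "ideal A R" "ideal B R" "A \<subseteq> B" "B \<subseteq> carrier R" for A B
    using that set_add_eq_right[OF that(1-3)] proper_ideal_le_max_ideal[of B] max_ideal(3) by auto
  from ideals_chain[OF assms] show ?thesis
  proof
    assume "I \<subseteq> J"
    then show ?thesis by (rule *(1)[OF assms _ sub(2)])
  next
    assume "J \<subseteq> I"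
    then show ?thesis by (rule *(2)[OF assms(2,1) _ sub(1)])
  qed
qed

text \<open>Of two nontrivial ideals one is not maximal; it serves as the component
  \<open>k i\<close> of the tuple graph. The maximal ideal contains both, so it is not zero.\<close>

lemma third_ideal:
  assumes "\<exists>I\<in>nontrivial_ideals R. \<exists>J\<in>nontrivial_ideals R. I \<noteq> J"
  shows "max_ideal \<noteq> {\<zero>}"
    and "\<exists>K. ideal K R \<and> K \<noteq> carrier R \<and> K \<noteq> max_ideal \<and> K \<noteq> {\<zero>}"
proof -
  obtain I J where IJ: "I \<in> nontrivial_ideals R" "J \<in> nontrivial_ideals R" "I \<noteq> J"
    using assms by blast
  then have "ideal I R" "I \<subseteq> max_ideal" "I \<noteq> {\<zero>}"
    using proper_ideal_le_max_ideal unfolding nontrivial_ideals_def by auto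
  then show "max_ideal \<noteq> {\<zero>}"
    using additive_subgroup.zero_closed ideal.axioms(1) by blast
  show "\<exists>K. ideal K R \<and> K \<noteq> carrier R \<and> K \<noteq> max_ideal \<and> K \<noteq> {\<zero>}"
  proof (cases "I = max_ideal")
    case True
    then show ?thesis
      using IJ(2,3) unfolding nontrivial_ideals_def by blast
  next
    case False
    then show ?thesis
      using IJ(1) unfolding nontrivial_ideals_def by blast
  qed
qed

end


section \<open>Ideals of a finite product of rings\<close>

lemma (in ring_hom_ring) ideal_image:
  assumes "h ` carrier R = carrier S" "ideal J R"
  shows "ideal (h ` J) S"
proof (rule idealI)
  have J: "J \<subseteq> carrier R"
    using assms(2) additive_subgroup.a_subset ideal.axioms(1) by blast
  show "ring S" by (rule S.ring_axioms)
  show "subgroup (h ` J) (add_monoid S)"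
    using group_hom.subgroup_img_is_subgroup[OF a_group_hom]
      additive_subgroup.a_subgroup[OF ideal.axioms(1)[OF assms(2)]] by blast
  fix a x assume "a \<in> h ` J" "x \<in> carrier S"
  then obtain b y where "b \<in> J" "a = h b" "y \<in> carrier R" "x = h y"
    using assms(1) by blast
  moreover from this have "b \<in> carrier R" using J by blast
  ultimately show "x \<otimes>\<^bsub>S\<^esub> a \<in> h ` J" "a \<otimes>\<^bsub>S\<^esub> x \<in> h ` J"
    using ideal.I_l_closed[OF assms(2)] ideal.I_r_closed[OF assms(2)] by (auto simp flip: hom_mult)
qed

text \<open>Characterises a finite product by projections that are jointly injective and surjective,
  independently of how its elements are represented.\<close>

locale ring_product = cring R
  for R :: "('a, 'm) ring_scheme" (structure) +
  fixes n :: nat and S :: "nat \<Rightarrow> ('b, 'n) ring_scheme" and \<pi> :: "nat \<Rightarrow> 'a \<Rightarrow> 'b"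
  assumes n_pos: "0 < n"
    and cring_factor: "i < n \<Longrightarrow> cring (S i)"
    and proj_hom: "i < n \<Longrightarrow> \<pi> i \<in> ring_hom R (S i)"
    and proj_inj: "\<lbrakk>x \<in> carrier R; y \<in> carrier R; \<And>i. i < n \<Longrightarrow> \<pi> i x = \<pi> i y\<rbrakk> \<Longrightarrow> x = y"
    and proj_surj: "(\<And>i. i < n \<Longrightarrow> f i \<in> carrier (S i)) \<Longrightarrow> \<exists>x\<in>carrier R. \<forall>i<n. \<pi> i x = f i"
begin

lemma proj_ring_hom_ring: "i < n \<Longrightarrow> ring_hom_ring R (S i) (\<pi> i)"
  by (intro ring_hom_ringI2 ring_axioms cring.axioms(1) cring_factor proj_hom)

lemma ring_factor: "i < n \<Longrightarrow> ring (S i)"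
  using cring_factor cring.axioms(1) by blast

lemma proj_simps:
  assumes "i < n"
  shows "x \<in> carrier R \<Longrightarrow> \<pi> i x \<in> carrier (S i)"
    "\<lbrakk>x \<in> carrier R; y \<in> carrier R\<rbrakk> \<Longrightarrow> \<pi> i (x \<oplus> y) = \<pi> i x \<oplus>\<^bsub>S i\<^esub> \<pi> i y"
    "\<lbrakk>x \<in> carrier R; y \<in> carrier R\<rbrakk> \<Longrightarrow> \<pi> i (x \<otimes> y) = \<pi> i x \<otimes>\<^bsub>S i\<^esub> \<pi> i y"
    "\<pi> i \<one> = \<one>\<^bsub>S i\<^esub>" "\<pi> i \<zero> = \<zero>\<^bsub>S i\<^esub>"
  using ring_hom_memE[OF proj_hom[OF assms]]
    ring_hom_zero[OF proj_hom[OF assms] ring_axioms ring_factor[OF assms]] by simp_all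

text \<open>With the unit of \<open>S i\<close> as \<open>a\<close>, this yields the orthogonal
  idempotents that isolate one component.\<close>

lemma embed_exists:
  assumes "i < n" "a \<in> carrier (S i)"
  obtains x where "x \<in> carrier R" "\<pi> i x = a" "\<And>j. \<lbrakk>j < n; j \<noteq> i\<rbrakk> \<Longrightarrow> \<pi> j x = \<zero>\<^bsub>S j\<^esub>"
proof -
  have "\<exists>x\<in>carrier R. \<forall>j<n. \<pi> j x = (if j = i then a else \<zero>\<^bsub>S j\<^esub>)"
    using assms ring_factor by (intro proj_surj) (auto simp: ring.ring_simprules)
  then show ?thesis
    using that assms by (metis (full_types))
qed

lemma proj_image_carrier: "i < n \<Longrightarrow> \<pi> i ` carrier R = carrier (S i)"
  using proj_simps(1) embed_exists by (auto simp: image_iff) metis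

lemma ideal_proj: "\<lbrakk>i < n; ideal J R\<rbrakk> \<Longrightarrow> ideal (\<pi> i ` J) (S i)"
  by (rule ring_hom_ring.ideal_image[OF proj_ring_hom_ring proj_image_carrier])

text \<open>Multiplying by these idempotents stays inside \<open>J\<close>, so components taken from
  different members of \<open>J\<close> can be assembled into one member. Hence an ideal is
  determined by its projections.\<close>

lemma mem_ideal_iff:
  assumes J: "ideal J R"
  shows "r \<in> J \<longleftrightarrow> r \<in> carrier R \<and> (\<forall>i<n. \<pi> i r \<in> \<pi> i ` J)"
proof (intro iffI conjI)
  show "r \<in> carrier R" if "r \<in> J"
    using that ideal.Icarr[OF J] by blast
  assume r: "r \<in> carrier R \<and> (\<forall>i<n. \<pi> i r \<in> \<pi> i ` J)"
  \<comment> \<open>Induction on the number of components already matched; the zeros elsewhere let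
    the next component be added without disturbing the others.\<close>
  have "\<exists>s\<in>J. \<forall>i<n. \<pi> i s = (if i < m then \<pi> i r else \<zero>\<^bsub>S i\<^esub>)" if "m \<le> n" for m
    using that
  proof (induction m)
    case 0
    then show ?case
      using additive_subgroup.zero_closed[OF ideal.axioms(1)[OF J]] proj_simps(5) by force
  next
    case (Suc m)
    then have m: "m < n" by simp
    obtain s where s: "s \<in> J" "\<And>i. i < n \<Longrightarrow> \<pi> i s = (if i < m then \<pi> i r else \<zero>\<^bsub>S i\<^esub>)"
      using Suc by auto
    obtain t where t: "t \<in> J" "\<pi> m r = \<pi> m t"
      using r m by blast
    interpret Sm: ring "S m" by (rule ring_factor[OF m])
    obtain e where e: "e \<in> carrier R" "\<pi> m e = \<one>\<^bsub>S m\<^esub>"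
        "\<And>j. \<lbrakk>j < n; j \<noteq> m\<rbrakk> \<Longrightarrow> \<pi> j e = \<zero>\<^bsub>S j\<^esub>"
      using embed_exists[OF m, of "\<one>\<^bsub>S m\<^esub>"] by auto
    have carr: "s \<in> carrier R" "t \<in> carrier R" "e \<otimes> t \<in> carrier R"
      using s t e ideal.Icarr[OF J] by auto
    have "s \<oplus> e \<otimes> t \<in> J"
      using s t e J by (simp add: additive_subgroup.a_closed ideal.axioms(1) ideal.I_l_closed)
    moreover have "\<pi> i (s \<oplus> e \<otimes> t) = (if i < Suc m then \<pi> i r else \<zero>\<^bsub>S i\<^esub>)" if i: "i < n" for i
    proof -
      interpret Si: ring "S i" by (rule ring_factor[OF i])
      have "\<pi> i (s \<oplus> e \<otimes> t) = \<pi> i s \<oplus>\<^bsub>S i\<^esub> \<pi> i e \<otimes>\<^bsub>S i\<^esub> \<pi> i t"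
        using carr e(1) by (simp add: proj_simps[OF i])
      then show ?thesis
        using s(2)[OF i] e(2,3) t(2) i m r carr proj_simps(1)[OF i carr(2)] by (cases "i = m") (auto simp: proj_simps[OF i])
    qed
    ultimately show ?case by blast
  qed
  from this[of n] obtain s where "s \<in> J" "\<And>i. i < n \<Longrightarrow> \<pi> i s = \<pi> i r"
    by auto
  then show "r \<in> J"
    using proj_inj[of s r] r ideal.Icarr[OF J] by auto
qed auto

lemma ideal_eqI:
  assumes "ideal I R" "ideal J R" "\<And>i. i < n \<Longrightarrow> \<pi> i ` I = \<pi> i ` J"
  shows "I = J"
  using mem_ideal_iff[OF assms(1)] mem_ideal_iff[OF assms(2)] assms(3) by blast

lemma product_ideal:
  assumes "\<And>i. i < n \<Longrightarrow> ideal (f i) (S i)"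
  obtains J where "ideal J R" "\<And>i. i < n \<Longrightarrow> \<pi> i ` J = f i"
proof -
  \<comment> \<open>Because \<open>n\<close> is positive, the family is not empty and its
    intersection stays inside the carrier.\<close>
  let ?J = "\<Inter>((\<lambda>i. {r \<in> carrier R. \<pi> i r \<in> f i}) ` {..<n})"
  have J: "ideal ?J R"
    using n_pos assms ring_hom_ring.ideal_vimage[OF proj_ring_hom_ring]
    by (intro i_Intersect) auto
  have "\<pi> i ` ?J = f i" if i: "i < n" for i
  proof
    show "\<pi> i ` ?J \<subseteq> f i" using i by auto
    show "f i \<subseteq> \<pi> i ` ?J"
    proof
      fix a assume a: "a \<in> f i"
      then obtain x where x: "x \<in> carrier R" "\<pi> i x = a"
          "\<And>j. \<lbrakk>j < n; j \<noteq> i\<rbrakk> \<Longrightarrow> \<pi> j x = \<zero>\<^bsub>S j\<^esub>"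
        using embed_exists[OF i] ideal.Icarr[OF assms[OF i]] by metis
      then have "\<pi> j x \<in> f j" if j: "j < n" for j
        using a j additive_subgroup.zero_closed[OF ideal.axioms(1)[OF assms[OF j]]]
        by (cases "j = i") auto
      then show "a \<in> \<pi> i ` ?J"
        using x by auto
    qed
  qed
  then show ?thesis
    using that J by blast
qed

lemma proj_set_add:
  assumes "i < n" "I \<subseteq> carrier R" "J \<subseteq> carrier R"
  shows "\<pi> i ` (I <+> J) = \<pi> i ` I <+>\<^bsub>S i\<^esub> \<pi> i ` J"
proof -
  have *: "\<pi> i (x \<oplus> y) = \<pi> i x \<oplus>\<^bsub>S i\<^esub> \<pi> i y" if "x \<in> I" "y \<in> J" for x y
    using that assms(2,3) by (intro proj_simps(2)[OF assms(1)]) auto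
  show ?thesis
    unfolding set_add_def' using * by (auto simp: image_iff) (metis+)
qed

text \<open>If component \<open>i\<close> of a prime ideal is proper, the idempotent of
  \<open>i\<close> is not in the ideal. Its product with the idempotent of any other index
  \<open>j\<close> is zero, so the latter is in the ideal and component \<open>j\<close> is
  full.\<close>

lemma primeideal_iff_proj:
  assumes J: "ideal J R"
  shows "primeideal J R \<longleftrightarrow>
    (\<exists>i<n. primeideal (\<pi> i ` J) (S i) \<and> (\<forall>j<n. j \<noteq> i \<longrightarrow> \<pi> j ` J = carrier (S j)))"
proof
  assume prime: "primeideal J R"
  have "\<exists>i<n. \<pi> i ` J \<noteq> carrier (S i)"
    using ideal_eqI[OF J oneideal] proj_image_carrier primeideal.I_notcarr[OF prime] by metis
  then obtain i where i: "i < n" "\<pi> i ` J \<noteq> carrier (S i)" by blast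
  interpret Si: cring "S i" by (rule cring_factor[OF i(1)])
  obtain e where e: "e \<in> carrier R" "\<pi> i e = \<one>\<^bsub>S i\<^esub>"
      "\<And>j. \<lbrakk>j < n; j \<noteq> i\<rbrakk> \<Longrightarrow> \<pi> j e = \<zero>\<^bsub>S j\<^esub>"
    using embed_exists[OF i(1), of "\<one>\<^bsub>S i\<^esub>"] by auto
  have "e \<notin> J"
    using ideal.one_imp_carrier[OF ideal_proj[OF i(1) J]] i(2) e(2) by (metis imageI)
  have others: "\<pi> j ` J = carrier (S j)" if j: "j < n" "j \<noteq> i" for j
  proof -
    interpret Sj: cring "S j" by (rule cring_factor[OF j(1)])
    obtain d where d: "d \<in> carrier R" "\<pi> j d = \<one>\<^bsub>S j\<^esub>"
        "\<And>l. \<lbrakk>l < n; l \<noteq> j\<rbrakk> \<Longrightarrow> \<pi> l d = \<zero>\<^bsub>S l\<^esub>"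
      using embed_exists[OF j(1), of "\<one>\<^bsub>S j\<^esub>"] by auto
    have "e \<otimes> d = \<zero>"
    proof (rule proj_inj)
      fix l assume l: "l < n"
      interpret Sl: cring "S l" by (rule cring_factor[OF l])
      have "\<pi> l (e \<otimes> d) = \<pi> l e \<otimes>\<^bsub>S l\<^esub> \<pi> l d" "\<pi> l e \<in> carrier (S l)"
          "\<pi> l d \<in> carrier (S l)" "\<pi> l \<zero> = \<zero>\<^bsub>S l\<^esub>"
        using e(1) d(1) by (simp_all add: proj_simps[OF l])
      moreover have "\<pi> l e = \<zero>\<^bsub>S l\<^esub> \<or> \<pi> l d = \<zero>\<^bsub>S l\<^esub>"
        using e(3) d(3) j l by metis
      ultimately show "\<pi> l (e \<otimes> d) = \<pi> l \<zero>"
        by auto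
    qed (use e d in auto)
    then have "d \<in> J"
      using primeideal.I_prime[OF prime e(1) d(1)] \<open>e \<notin> J\<close>
        additive_subgroup.zero_closed[OF ideal.axioms(1)[OF J]] by auto
    then show ?thesis
      using ideal.one_imp_carrier[OF ideal_proj[OF j(1) J]] d(2) by (metis imageI)
  qed
  have "primeideal (\<pi> i ` J) (S i)"
  proof (rule primeidealI)
    show "ideal (\<pi> i ` J) (S i)" by (rule ideal_proj[OF i(1) J])
    show "cring (S i)" by (rule Si.is_cring)
    show "carrier (S i) \<noteq> \<pi> i ` J" using i(2) by simp
    fix a b assume ab: "a \<in> carrier (S i)" "b \<in> carrier (S i)" "a \<otimes>\<^bsub>S i\<^esub> b \<in> \<pi> i ` J"
    obtain x y where xy: "x \<in> carrier R" "\<pi> i x = a" "y \<in> carrier R" "\<pi> i y = b"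
      using ab(1,2) proj_image_carrier[OF i(1)] by (metis imageE)
    have "\<pi> l (x \<otimes> y) \<in> \<pi> l ` J" if l: "l < n" for l
    proof (cases "l = i")
      case True
      then show ?thesis using xy ab(3) proj_simps(3)[OF i(1)] by simp
    next
      case False
      then show ?thesis using others[OF l] xy proj_simps(1)[OF l] by simp
    qed
    then have "x \<otimes> y \<in> J"
      using xy(1,3) mem_ideal_iff[OF J, of "x \<otimes> y"] by blast
    then show "a \<in> \<pi> i ` J \<or> b \<in> \<pi> i ` J"
      using primeideal.I_prime[OF prime xy(1,3)] xy(2,4) by (metis imageI)
  qed
  then show "\<exists>i<n. primeideal (\<pi> i ` J) (S i) \<and> (\<forall>j<n. j \<noteq> i \<longrightarrow> \<pi> j ` J = carrier (S j))"
    using i(1) others by blast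
next
  assume "\<exists>i<n. primeideal (\<pi> i ` J) (S i) \<and> (\<forall>j<n. j \<noteq> i \<longrightarrow> \<pi> j ` J = carrier (S j))"
  then obtain i where i: "i < n" "primeideal (\<pi> i ` J) (S i)"
      "\<And>j. \<lbrakk>j < n; j \<noteq> i\<rbrakk> \<Longrightarrow> \<pi> j ` J = carrier (S j)"
    by blast
  \<comment> \<open>All components except the one at \<open>i\<close> are full, so membership in
    \<open>J\<close> is decided at \<open>i\<close> and primality carries over.\<close>
  have mem: "r \<in> J \<longleftrightarrow> \<pi> i r \<in> \<pi> i ` J" if r: "r \<in> carrier R" for r
  proof
    assume a: "\<pi> i r \<in> \<pi> i ` J"
    have "\<pi> j r \<in> \<pi> j ` J" if "j < n" for j
      using a i(3)[OF that] proj_simps(1)[OF that r] by (cases "j = i") simp_all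
    then show "r \<in> J"
      using mem_ideal_iff[OF J] r by blast
  qed blast
  show "primeideal J R"
  proof (rule primeidealI[OF J is_cring])
    show "carrier R \<noteq> J"
      using primeideal.I_notcarr[OF i(2)] proj_image_carrier[OF i(1)] by auto
    fix a b assume "a \<in> carrier R" "b \<in> carrier R" "a \<otimes> b \<in> J"
    then show "a \<in> J \<or> b \<in> J"
      using primeideal.I_prime[OF i(2), of "\<pi> i a" "\<pi> i b"] mem proj_simps[OF i(1)] by simp
  qed
qed

section \<open>The prime ideal sum graph of a product of chain rings\<close>

lemma PIS_tuple_graph:
  assumes "2 \<le> n"
    and special: "\<And>i. i < n \<Longrightarrow> special_principal_ring (S i)"
    and nontrivial: "\<And>i. i < n \<Longrightarrow> \<exists>I\<in>nontrivial_ideals (S i). \<exists>J\<in>nontrivial_ideals (S i). I \<noteq> J"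
  obtains k where
    "tuple_graph (PIS R) n (\<lambda>i. {I. ideal I (S i)}) (\<lambda>J i. \<pi> i ` J) (\<lambda>i. carrier (S i))
      (\<lambda>i. special_principal_ring.max_ideal (S i)) k (\<lambda>i. {\<zero>\<^bsub>S i\<^esub>})"
proof -
  let ?M = "\<lambda>i. special_principal_ring.max_ideal (S i)"
  have "\<forall>i\<in>{..<n}. \<exists>K. ideal K (S i) \<and> K \<noteq> carrier (S i) \<and> K \<noteq> ?M i \<and> K \<noteq> {\<zero>\<^bsub>S i\<^esub>}"
    using special_principal_ring.third_ideal(2)[OF special nontrivial] by auto
  from bchoice[OF this] obtain k where k: "\<And>i. i < n \<Longrightarrow> ideal (k i) (S i)"
      "\<And>i. i < n \<Longrightarrow> k i \<noteq> carrier (S i)" "\<And>i. i < n \<Longrightarrow> k i \<noteq> ?M i"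
      "\<And>i. i < n \<Longrightarrow> k i \<noteq> {\<zero>\<^bsub>S i\<^esub>}"
    by auto
  have verts: "J \<in> pverts (PIS R) \<longleftrightarrow> ideal J R \<and> J \<noteq> {\<zero>} \<and> J \<noteq> carrier R" for J
    unfolding PIS_def nontrivial_ideals_def by auto
  have "tuple_graph (PIS R) n (\<lambda>i. {I. ideal I (S i)}) (\<lambda>J i. \<pi> i ` J) (\<lambda>i. carrier (S i))
      ?M k (\<lambda>i. {\<zero>\<^bsub>S i\<^esub>})"
  proof (intro tuple_graph.intro PIS_bidirected tuple_graph_axioms.intro)
    show "2 \<le> n" by fact
    fix i assume i: "i < n"
    interpret Si: special_principal_ring "S i" by (rule special[OF i])
    show "finite {I. ideal I (S i)}" by (rule Si.finite_ideals)
    show "carrier (S i) \<in> {I. ideal I (S i)}" using Si.oneideal by simp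
    show "?M i \<in> {I. ideal I (S i)}" using Si.max_ideal by simp
    show "k i \<in> {I. ideal I (S i)}" using k i by simp
    show "?M i \<noteq> carrier (S i)" using Si.max_ideal by simp
    show "?M i \<noteq> {\<zero>\<^bsub>S i\<^esub>}" using Si.third_ideal nontrivial i by blast
    show "k i \<noteq> carrier (S i)" "k i \<noteq> ?M i" "k i \<noteq> {\<zero>\<^bsub>S i\<^esub>}" using k i by auto
  next
    fix J i assume "J \<in> pverts (PIS R)" "i < n"
    then show "\<pi> i ` J \<in> {I. ideal I (S i)}"
      using verts ideal_proj by auto
  next
    fix I J assume "I \<in> pverts (PIS R)" "J \<in> pverts (PIS R)" "\<And>i. i < n \<Longrightarrow> \<pi> i ` I = \<pi> i ` J"
    then show "I = J"
      using verts ideal_eqI by auto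
  next
    fix J assume "J \<in> pverts (PIS R)"
    then show "\<exists>i<n. \<pi> i ` J \<noteq> carrier (S i)"
      using verts ideal_eqI[OF _ oneideal] proj_image_carrier by metis
  next
    fix f assume f: "\<And>i. i < n \<Longrightarrow> f i \<in> {I. ideal I (S i)}" "\<exists>i<n. f i \<noteq> carrier (S i)"
      "\<exists>i<n. f i \<noteq> {\<zero>\<^bsub>S i\<^esub>}"
    obtain J where J: "ideal J R" "\<And>i. i < n \<Longrightarrow> \<pi> i ` J = f i"
      using product_ideal[of f] f(1) by auto
    have "J \<noteq> carrier R"
      using J(2) f(2) proj_image_carrier by metis
    moreover have "J \<noteq> {\<zero>}"
      using J(2) f(3) proj_simps(5) by force
    ultimately show "\<exists>J\<in>pverts (PIS R). \<forall>i<n. \<pi> i ` J = f i"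
      using J verts by blast
  next
    fix I J assume IJ: "I \<in> pverts (PIS R)" "J \<in> pverts (PIS R)" "I \<noteq> J"
    then have ideals: "ideal I R" "ideal J R"
      using verts by auto
    then have sub: "I \<subseteq> carrier R" "J \<subseteq> carrier R"
      using additive_subgroup.a_subset ideal.axioms(1) by blast+
    \<comment> \<open>In a chain ring, primality means equality with the maximal ideal and a sum is
      the larger summand, so both conditions on the sum become conditions on the two
      components.\<close>
    have prime_i: "primeideal (\<pi> i ` (I <+> J)) (S i) \<longleftrightarrow>
        \<pi> i ` I \<noteq> carrier (S i) \<and> \<pi> i ` J \<noteq> carrier (S i) \<and> (\<pi> i ` I = ?M i \<or> \<pi> i ` J = ?M i)"
      and full_i: "\<pi> i ` (I <+> J) = carrier (S i) \<longleftrightarrow>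
        \<pi> i ` I = carrier (S i) \<or> \<pi> i ` J = carrier (S i)" if i: "i < n" for i
    proof -
      interpret Si: special_principal_ring "S i" by (rule special[OF i])
      note id_i = ideal_proj[OF i ideals(1)] ideal_proj[OF i ideals(2)]
      show "primeideal (\<pi> i ` (I <+> J)) (S i) \<longleftrightarrow>
        \<pi> i ` I \<noteq> carrier (S i) \<and> \<pi> i ` J \<noteq> carrier (S i) \<and> (\<pi> i ` I = ?M i \<or> \<pi> i ` J = ?M i)"
        using Si.set_add_eq_max_ideal_iff[OF id_i] Si.primeideal_iff_max_ideal
        by (simp add: proj_set_add[OF i sub])
      show "\<pi> i ` (I <+> J) = carrier (S i) \<longleftrightarrow>
        \<pi> i ` I = carrier (S i) \<or> \<pi> i ` J = carrier (S i)"
        using Si.set_add_eq_carrier_iff[OF id_i] by (simp add: proj_set_add[OF i sub])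
    qed
    have "(I, J) \<in> parcs (PIS R) \<longleftrightarrow> primeideal (I <+> J) R"
      using IJ unfolding PIS_def by auto
    also have "\<dots> \<longleftrightarrow> (\<exists>i<n. primeideal (\<pi> i ` (I <+> J)) (S i) \<and>
        (\<forall>j<n. j \<noteq> i \<longrightarrow> \<pi> j ` (I <+> J) = carrier (S j)))"
      by (rule primeideal_iff_proj[OF add_ideals[OF ideals]])
    also have "\<dots> \<longleftrightarrow> (\<exists>i<n. \<pi> i ` I \<noteq> carrier (S i) \<and> \<pi> i ` J \<noteq> carrier (S i) \<and>
        (\<pi> i ` I = ?M i \<or> \<pi> i ` J = ?M i) \<and>
        (\<forall>j<n. j \<noteq> i \<longrightarrow> \<pi> j ` I = carrier (S j) \<or> \<pi> j ` J = carrier (S j)))"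
      by (simp add: prime_i full_i conj_assoc cong: conj_cong)
    finally show "(I, J) \<in> parcs (PIS R) \<longleftrightarrow> \<dots>" .
  qed
  then show ?thesis
    using that by blast
qed

end

section \<open>Direct products whose elements are lists\<close>

lemma RDirProd_list_Cons_simps:
  assumes "x \<in> carrier R" "y \<in> carrier R" "xs \<in> carrier (RDirProd_list Rs)"
    "ys \<in> carrier (RDirProd_list Rs)"
  shows "(x # xs) \<otimes>\<^bsub>RDirProd_list (R # Rs)\<^esub> (y # ys) =
      (x \<otimes>\<^bsub>R\<^esub> y) # (xs \<otimes>\<^bsub>RDirProd_list Rs\<^esub> ys)"
    and "(x # xs) \<oplus>\<^bsub>RDirProd_list (R # Rs)\<^esub> (y # ys) =
      (x \<oplus>\<^bsub>R\<^esub> y) # (xs \<oplus>\<^bsub>RDirProd_list Rs\<^esub> ys)"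
  using ring_hom_memE(2,3)[OF RDirProd_list_hom1[of R Rs], of "(x, xs)" "(y, ys)"] assms
  by (auto simp: RDirProd_carrier) (auto simp: RDirProd_def DirProd_def monoid.defs)

lemma RDirProd_list_nth_hom:
  assumes "i < length Rs"
  shows "(\<lambda>xs. xs ! i) \<in> ring_hom (RDirProd_list Rs) (Rs ! i)"
  using assms
proof (induction Rs arbitrary: i)
  case (Cons R Rs)
  show ?case
  proof (rule ring_hom_memI)
    show "xs ! i \<in> carrier ((R # Rs) ! i)" if "xs \<in> carrier (RDirProd_list (R # Rs))" for xs
      using RDirProd_list_carrier_mem(2)[OF that] Cons.prems by simp
    show "\<one>\<^bsub>RDirProd_list (R # Rs)\<^esub> ! i = \<one>\<^bsub>(R # Rs) ! i\<^esub>"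
      using Cons ring_hom_memE(4)[OF Cons.IH] by (cases i) (auto simp: RDirProd_list_one)
    fix us vs assume "us \<in> carrier (RDirProd_list (R # Rs))" "vs \<in> carrier (RDirProd_list (R # Rs))"
    then obtain x xs y ys where *: "us = x # xs" "vs = y # ys" "x \<in> carrier R" "y \<in> carrier R"
        "xs \<in> carrier (RDirProd_list Rs)" "ys \<in> carrier (RDirProd_list Rs)"
      by (auto simp: RDirProd_list_carrier)
    show "(us \<otimes>\<^bsub>RDirProd_list (R # Rs)\<^esub> vs) ! i = us ! i \<otimes>\<^bsub>(R # Rs) ! i\<^esub> vs ! i"
      using * Cons ring_hom_memE(2)[OF Cons.IH] by (cases i) (auto simp: RDirProd_list_Cons_simps)
    show "(us \<oplus>\<^bsub>RDirProd_list (R # Rs)\<^esub> vs) ! i = us ! i \<oplus>\<^bsub>(R # Rs) ! i\<^esub> vs ! i"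
      using * Cons ring_hom_memE(3)[OF Cons.IH] by (cases i) (auto simp: RDirProd_list_Cons_simps)
  qed
qed simp

text \<open>The projections are the isomorphism followed by list indexing. Their joint injectivity
  rests on all lists in the carrier having the same length.\<close>

lemma ring_product_if_iso_RDirProd_list:
  assumes "cring R" "Rs \<noteq> []" "\<And>S. S \<in> set Rs \<Longrightarrow> cring S" "h \<in> ring_iso R (RDirProd_list Rs)"
  shows "ring_product R (length Rs) (\<lambda>i. Rs ! i) (\<lambda>i r. h r ! i)"
proof (intro ring_product.intro assms(1) ring_product_axioms.intro)
  have h: "h \<in> ring_hom R (RDirProd_list Rs)" "bij_betw h (carrier R) (carrier (RDirProd_list Rs))"
    using assms(4) unfolding ring_iso_def by auto
  show "0 < length Rs" using assms(2) by simp
  show "cring (Rs ! i)" if "i < length Rs" for i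
    using that assms(3) by simp
  show "(\<lambda>r. h r ! i) \<in> ring_hom R (Rs ! i)" if "i < length Rs" for i
    using ring_hom_trans[OF h(1) RDirProd_list_nth_hom[OF that]] by (simp add: comp_def)
  show "x = y" if "x \<in> carrier R" "y \<in> carrier R" "\<And>i. i < length Rs \<Longrightarrow> h x ! i = h y ! i" for x y
  proof -
    have "length (h z) = length Rs" if "z \<in> carrier R" for z
      using RDirProd_list_carrier_mem(1)[OF ring_hom_memE(1)[OF h(1) that]] .
    then have "h x = h y"
      using that by (intro nth_equalityI) auto
    then show ?thesis
      using that(1,2) h(2) unfolding bij_betw_def inj_on_def by blast
  qed
  show "\<exists>x\<in>carrier R. \<forall>i<length Rs. h x ! i = f i"
    if f: "\<And>i. i < length Rs \<Longrightarrow> f i \<in> carrier (Rs ! i)" for f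
  proof -
    have "map f [0..<length Rs] \<in> carrier (RDirProd_list Rs)"
      using f by (intro RDirProd_list_carrier_memI) auto
    then obtain x where "x \<in> carrier R" "h x = map f [0..<length Rs]"
      using h(2) unfolding bij_betw_def by (metis imageE)
    then show ?thesis
      by (intro bexI[of _ x]) simp_all
  qed
qed

theorem theorem4p7:
  fixes R :: "('a, 'm) ring_scheme"
    and Rs :: "('b, 'n) ring_scheme list"
    and n :: nat
  assumes "artinian_ring R" and "\<not> local_ring R"
    and "n \<ge> 2" and "length Rs = n"
    and "\<And>S. S \<in> set Rs \<Longrightarrow> artinian_ring S \<and> local_ring S \<and> principal_ideal_ring S"
    and "\<And>S. S \<in> set Rs \<Longrightarrow> \<exists>I\<in>nontrivial_ideals S. \<exists>J\<in>nontrivial_ideals S. I \<noteq> J"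
    and "R \<simeq> RDirProd_list Rs"
  shows "int (sdim (PIS R)) = int (card (pverts (PIS R))) - int n - 1"
proof -
  obtain h where h: "h \<in> ring_iso R (RDirProd_list Rs)"
    using assms(7) unfolding is_ring_iso_def by blast
  interpret ring_product R "length Rs" "\<lambda>i. Rs ! i" "\<lambda>i r. h r ! i"
  proof (rule ring_product_if_iso_RDirProd_list[OF _ _ _ h])
    show "cring R" using assms(1) by (rule artinian_ring.axioms(1))
    show "Rs \<noteq> []" using assms(3,4) by auto
    show "cring S" if "S \<in> set Rs" for S
      using assms(5)[OF that] artinian_ring.axioms(1) by blast
  qed
  obtain k where "tuple_graph (PIS R) (length Rs) (\<lambda>i. {I. ideal I (Rs ! i)}) (\<lambda>J i. (\<lambda>r. h r ! i) ` J)
      (\<lambda>i. carrier (Rs ! i)) (\<lambda>i. special_principal_ring.max_ideal (Rs ! i)) k (\<lambda>i. {\<zero>\<^bsub>Rs ! i\<^esub>})"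
  proof (rule PIS_tuple_graph)
    show "2 \<le> length Rs" using assms(3,4) by simp
    show "special_principal_ring (Rs ! i)" if "i < length Rs" for i
      using assms(5)[of "Rs ! i"] that by (auto intro: special_principal_ring.intro)
    show "\<exists>I\<in>nontrivial_ideals (Rs ! i). \<exists>J\<in>nontrivial_ideals (Rs ! i). I \<noteq> J"
      if "i < length Rs" for i
      using assms(6)[of "Rs ! i"] that by simp
  qed
  then show ?thesis
    using tuple_graph.sdim_tuple_graph assms(4) by fastforce
qed

end
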